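(* Let $A$ be an alphabet with $|A|=k$, and let $\mathrm{lp}G_{k,1}$ be the subgroup of length-preserving elements of the Thompson-Higman group $G_{k,1}$. Then $\mathrm{lp}G_{k,1}$ is isomorphic to the direct limit (over $n\ge 1$) of the sequence of diagonal embeddings $\otimes\,\mathrm{id}_A:\ \mathfrak{S}_{A^n}\hookrightarrow\mathfrak{S}_{A^{n+1}}$. When $k$ is even, each of these embeddings has image in the alternating group, and $\mathrm{lp}G_{k,1}$ is isomorphic to the direct limit of the sequence of embeddings $\mathfrak{S}_{A^n}\hookrightarrow\mathfrak{A}_{A^{n+1}}\subset\mathfrak{S}_{A^{n+1}}$.
   Context: Fix a finite alphabet $A$ with $|A|=k\ge 2$; $A^*$ is the set of finite words over $A$, $A^n$ the set of words of length $n$, $|w|$ the length of $w$. A right ideal of $A^*$ is a set $R$ with $RA^*\subseteq R$; it is essential if it meets every non-empty right ideal. Every right ideal has a unique minimal generating set, which is a prefix code (no element is a prefix of another); it is a maximal prefix code iff the right ideal is essential. An isomorphism $\varphi:R_1\to R_2$ between right ideals is a bijection with $\varphi(rz)=\varphi(r)z$ for all $r\in R_1$, $z\in A^*$. Every isomorphism between finitely generated essential right ideals has a unique maximal extension to an isomorphism between essential right ideals. $G_{k,1}$ is the group of all maximally extended isomorphisms between finitely generated essential right ideals of $A^*$, with multiplication: composition followed by maximal extension. Any isomorphism between finitely generated essential right ideals represents the element of $G_{k,1}$ given by its maximal extension; equivalently an element is represented by a bijection between two finite maximal prefix codes. $\mathrm{lp}G_{k,1}=\{\varphi\in G_{k,1}: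 |x|=|\varphi(x)| \text{ for all } x\in\mathrm{Dom}(\varphi)\}$. For a finite set $X$, $\mathfrak{S}_X$ and $\mathfrak{A}_X$ are the symmetric and alternating groups on $X$. For $\pi\in\mathfrak{S}_{A^n}$, $\pi\otimes\mathrm{id}_A\in\mathfrak{S}_{A^{n+1}}$ is defined by $(\pi\otimes\mathrm{id}_A)(xa)=\pi(x)\,a$ for $x\in A^n$, $a\in A$. *)

theory Defs
  imports "HOL-Algebra.Sym_Groups" "HOL-Library.Cardinality"
begin

text \<open>
  The alphabet is a finite type \<open>'a\<close>, so that \<open>A\<^sup>*\<close> is the type \<open>'a list\<close>. A map whose domain is
  a subset of \<open>A\<^sup>*\<close> is a partial function \<open>'a list \<rightharpoonup> 'a list\<close>.
\<close>

definition right_ideal :: "'a list set \<Rightarrow> bool" where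
  "right_ideal R \<longleftrightarrow> (\<forall>r\<in>R. \<forall>z. r @ z \<in> R)"

definition essential_right_ideal :: "'a list set \<Rightarrow> bool" where
  "essential_right_ideal R \<longleftrightarrow>
     right_ideal R \<and> (\<forall>I. right_ideal I \<and> I \<noteq> {} \<longrightarrow> R \<inter> I \<noteq> {})"

definition finitely_generated :: "'a list set \<Rightarrow> bool" where
  "finitely_generated R \<longleftrightarrow> (\<exists>C. finite C \<and> R = {c @ z |c z. c \<in> C})"

definition right_ideal_iso :: "('a list \<rightharpoonup> 'a list) \<Rightarrow> 'a list set \<Rightarrow> 'a list set \<Rightarrow> bool" where
  "right_ideal_iso \<phi> R\<^sub>1 R\<^sub>2 \<longleftrightarrow>
     right_ideal R\<^sub>1 \<and> right_ideal R\<^sub>2 \<and> dom \<phi> = R\<^sub>1 \<and>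
     bij_betw (\<lambda>r. the (\<phi> r)) R\<^sub>1 R\<^sub>2 \<and>
     (\<forall>r\<in>R\<^sub>1. \<forall>z. the (\<phi> (r @ z)) = the (\<phi> r) @ z)"

definition essential_iso :: "('a list \<rightharpoonup> 'a list) \<Rightarrow> bool" where
  "essential_iso \<phi> \<longleftrightarrow>
     (\<exists>R\<^sub>1 R\<^sub>2. essential_right_ideal R\<^sub>1 \<and> essential_right_ideal R\<^sub>2 \<and> right_ideal_iso \<phi> R\<^sub>1 R\<^sub>2)"

definition fg_essential_iso :: "('a list \<rightharpoonup> 'a list) \<Rightarrow> bool" where
  "fg_essential_iso \<phi> \<longleftrightarrow>
     (\<exists>R\<^sub>1 R\<^sub>2. essential_right_ideal R\<^sub>1 \<and> finitely_generated R\<^sub>1 \<and>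
              essential_right_ideal R\<^sub>2 \<and> finitely_generated R\<^sub>2 \<and> right_ideal_iso \<phi> R\<^sub>1 R\<^sub>2)"

definition maximally_extended :: "('a list \<rightharpoonup> 'a list) \<Rightarrow> bool" where
  "maximally_extended \<phi> \<longleftrightarrow>
     essential_iso \<phi> \<and> (\<forall>\<psi>. essential_iso \<psi> \<and> \<phi> \<subseteq>\<^sub>m \<psi> \<longrightarrow> \<psi> = \<phi>)"

definition max_extension :: "('a list \<rightharpoonup> 'a list) \<Rightarrow> ('a list \<rightharpoonup> 'a list)" where
  "max_extension \<phi> = (THE \<psi>. maximally_extended \<psi> \<and> \<phi> \<subseteq>\<^sub>m \<psi>)"

text \<open>\<open>G\<^bsub>k,1\<^esub>\<close> for \<open>k = CARD('a)\<close>; maps act on the left, so \<open>\<phi> \<otimes> \<psi>\<close> applies \<open>\<psi>\<close> first.\<close>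

definition thompson_higman :: "('a list \<rightharpoonup> 'a list) monoid" where
  "thompson_higman =
     \<lparr>carrier = {\<phi>. fg_essential_iso \<phi> \<and> maximally_extended \<phi>},
      mult = (\<lambda>\<phi> \<psi>. max_extension (\<phi> \<circ>\<^sub>m \<psi>)),
      one = Some\<rparr>"

definition lp_elements :: "('a list \<rightharpoonup> 'a list) set" where
  "lp_elements =
     {\<phi> \<in> carrier thompson_higman. \<forall>x\<in>dom \<phi>. length x = length (the (\<phi> x))}"

definition lp_thompson_higman :: "('a list \<rightharpoonup> 'a list) monoid" where
  "lp_thompson_higman = thompson_higman\<lparr>carrier := lp_elements\<rparr>"

text \<open>
  The library's \<^const>\<open>sym_group\<close> and \<^const>\<open>alt_group\<close> are restricted to the sets \<open>{1..n}\<close>;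
  these are the same definitions on an arbitrary finite set.
\<close>

definition sym_group_on :: "'b set \<Rightarrow> ('b \<Rightarrow> 'b) monoid" where
  "sym_group_on X = \<lparr>carrier = {p. p permutes X}, mult = (\<circ>), one = id\<rparr>"

definition alt_group_on :: "'b set \<Rightarrow> ('b \<Rightarrow> 'b) monoid" where
  "alt_group_on X = (sym_group_on X)\<lparr>carrier := {p. p permutes X \<and> evenperm p}\<rparr>"

definition words :: "nat \<Rightarrow> 'a list set" where
  "words n = {w. length w = n}"

text \<open>
  The diagonal map \<open>\<pi> \<mapsto> \<pi> \<otimes> id\<^sub>A\<close> from the permutations of \<open>A\<^sup>n\<close> to those of \<open>A\<^bsup>n+1\<^esup>\<close>; as
  required by \<^const>\<open>permutes\<close>, its values fix every word outside \<open>A\<^bsup>n+1\<^esup>\<close>.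
\<close>

definition tensor_id :: "nat \<Rightarrow> ('a list \<Rightarrow> 'a list) \<Rightarrow> ('a list \<Rightarrow> 'a list)" where
  "tensor_id n \<pi> = (\<lambda>w. if w \<in> words (Suc n) then \<pi> (butlast w) @ [last w] else w)"

text \<open>
  The direct limit of \<open>G 0 \<rightarrow> G 1 \<rightarrow> G 2 \<rightarrow> \<dots>\<close> with connecting maps \<open>f n : G n \<rightarrow> G (n + 1)\<close>,
  constructed as the disjoint union of the \<open>G n\<close> modulo eventual equality; \<open>shift f n j\<close> is the
  composite map \<open>G n \<rightarrow> G (n + j)\<close>.
\<close>

primrec shift :: "(nat \<Rightarrow> 'b \<Rightarrow> 'b) \<Rightarrow> nat \<Rightarrow> nat \<Rightarrow> 'b \<Rightarrow> 'b" where
  "shift f n 0 x = x"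
| "shift f n (Suc j) x = f (n + j) (shift f n j x)"

definition limit_rel ::
  "(nat \<Rightarrow> 'b monoid) \<Rightarrow> (nat \<Rightarrow> 'b \<Rightarrow> 'b) \<Rightarrow> ((nat \<times> 'b) \<times> (nat \<times> 'b)) set" where
  "limit_rel G f =
     {((m, x), (n, y)) |m x n y. x \<in> carrier (G m) \<and> y \<in> carrier (G n) \<and>
        (\<exists>i j. m + i = n + j \<and> shift f m i x = shift f n j y)}"

definition direct_limit ::
  "(nat \<Rightarrow> 'b monoid) \<Rightarrow> (nat \<Rightarrow> 'b \<Rightarrow> 'b) \<Rightarrow> (nat \<times> 'b) set monoid" where
  "direct_limit G f =
     \<lparr>carrier = (SIGMA n:UNIV. carrier (G n)) // limit_rel G f,
      mult = (\<lambda>X Y. \<Union>(m, x)\<in>X. \<Union>(n, y)\<in>Y.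
        limit_rel G f `` {(m + n, shift f m n x \<otimes>\<^bsub>G (m + n)\<^esub> shift f n m y)}),
      one = limit_rel G f `` {(0, \<one>\<^bsub>G 0\<^esub>)}\<rparr>"

text \<open>
  The sequence \<open>S(A\<^sup>1) \<rightarrow> Alt(A\<^sup>2) \<subseteq> S(A\<^sup>2) \<rightarrow> Alt(A\<^sup>3) \<subseteq> S(A\<^sup>3) \<rightarrow> \<dots>\<close>, in which symmetric groups
  occupy the even positions (\<open>S(A\<^sup>n)\<close> is at \<open>2(n - 1)\<close>) and alternating groups the odd ones. Its
  maps are alternately \<open>\<pi> \<mapsto> \<pi> \<otimes> id\<^sub>A\<close> and the inclusion.
\<close>

definition sym_alt_group :: "nat \<Rightarrow> ('a list \<Rightarrow> 'a list) monoid" where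
  "sym_alt_group i =
     (if even i then sym_group_on (words (i div 2 + 1)) else alt_group_on (words (i div 2 + 2)))"

definition sym_alt_map :: "nat \<Rightarrow> ('a list \<Rightarrow> 'a list) \<Rightarrow> ('a list \<Rightarrow> 'a list)" where
  "sym_alt_map i = (if even i then tensor_id (i div 2 + 1) else id)"

end

theory Submission
  imports Defs
begin

text \<open>
  A right ideal of \<open>A\<^sup>*\<close> is essential and finitely generated iff it contains all sufficiently
  long words, and an isomorphism has the same maximal extension as any of its restrictions to a
  smaller essential ideal. Hence a length-preserving element of the Thompson-Higman group is
  determined by the permutation it induces on \<open>A\<^sup>n\<close> for any large enough \<open>n\<close>, every such
  permutation arises, and passing from \<open>n\<close> to \<open>n + 1\<close> is \<open>\<otimes> id\<^sub>A\<close>. For even \<open>k\<close>, a transposition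
  tensored with \<open>id\<^sub>A\<close> is a product of \<open>k\<close> transpositions.
\<close>

section \<open>Right ideals and their isomorphisms\<close>

lemma ran_mono_map_le: "f \<subseteq>\<^sub>m g \<Longrightarrow> ran f \<subseteq> ran g"
  unfolding map_le_def ran_def dom_def by (auto, metis)

text \<open>Every non-empty right ideal contains a principal one, generated by a single word
  \<open>w\<close>, so essentiality need only be tested against these.\<close>

lemma essential_right_ideal_iff:
  fixes R :: "'a list set"
  shows "essential_right_ideal R \<longleftrightarrow> right_ideal R \<and> (\<forall>w. \<exists>z. w @ z \<in> R)"
proof (cases "right_ideal R")
  case R: True
  show ?thesis
  proof (intro iffI conjI R allI)
    fix w :: "'a list" assume *: "essential_right_ideal R"
    have "right_ideal (range ((@) w))" "range ((@) w) \<noteq> {}"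
      by (auto simp: right_ideal_def)
    with * have "R \<inter> range ((@) w) \<noteq> {}"
      unfolding essential_right_ideal_def by blast
    then show "\<exists>z. w @ z \<in> R" by auto
  next
    assume "right_ideal R \<and> (\<forall>w. \<exists>z. w @ z \<in> R)"
    then show "essential_right_ideal R"
      unfolding essential_right_ideal_def right_ideal_def by blast
  qed
qed (simp add: essential_right_ideal_def)

text \<open>If \<open>w\<close> is at least as long as every generator, some \<open>w @ z\<close>
  has a generator as a prefix, and that prefix already lies inside \<open>w\<close>. Conversely, if
  all words of length at least \<open>n\<close> belong to \<open>R\<close>, its members of length at
  most \<open>n\<close> generate it, and they are finitely many because the alphabet is
  finite.\<close>

lemma fg_essential_right_ideal_iff:
  fixes R :: "'a::finite list set"
  shows "essential_right_ideal R \<and> finitely_generated R \<longleftrightarrow>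
    right_ideal R \<and> (\<exists>n. \<forall>w. n \<le> length w \<longrightarrow> w \<in> R)"
proof (intro iffI conjI; elim conjE exE)
  assume ess: "essential_right_ideal R" and fg: "finitely_generated R"
  show "right_ideal R" using ess by (simp add: essential_right_ideal_def)
  from fg obtain C where C: "finite C" "R = {c @ z |c z. c \<in> C}"
    unfolding finitely_generated_def by blast
  \<comment> \<open>\<open>insert 0\<close> keeps \<open>Max\<close> meaningful without a separate
    argument that \<open>C\<close> is non-empty.\<close>
  have "w \<in> R" if w: "Max (insert 0 (length ` C)) \<le> length w" for w
  proof -
    obtain z c u where "w @ z = c @ u" "c \<in> C"
      using ess C(2) unfolding essential_right_ideal_iff by blast
    moreover from this have "length c \<le> length w"
      using w C(1) by auto
    moreover have "take (length w) (w @ z) = w" by simp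
    ultimately have "w = c @ take (length w - length c) u" "c \<in> C"
      by simp_all
    with C(2) show ?thesis by blast
  qed
  then show "\<exists>n. \<forall>w. n \<le> length w \<longrightarrow> w \<in> R" by blast
next
  fix n assume R: "right_ideal R" and n: "\<forall>w. n \<le> length w \<longrightarrow> w \<in> R"
  \<comment> \<open>Padding with any \<open>n\<close> letters passes the threshold;
    \<open>undefined\<close> is an arbitrary letter.\<close>
  have "w @ replicate n undefined \<in> R" for w using n by simp
  with R show "essential_right_ideal R" unfolding essential_right_ideal_iff by blast
  define C where "C = R \<inter> {w. length w \<le> n}"
  have "finite C"
    unfolding C_def using finite_lists_length_le[of "UNIV :: 'a set" n] by simp
  moreover have "R = {c @ z |c z. c \<in> C}"
  proof (intro equalityI subsetI)
    fix w assume w: "w \<in> R"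
    show "w \<in> {c @ z |c z. c \<in> C}"
    proof (cases "length w \<le> n")
      case True
      with w have "w \<in> C" "w = w @ []" by (auto simp: C_def)
      then show ?thesis by blast
    next
      case False
      then have "take n w \<in> C" using n by (simp add: C_def)
      moreover have "w = take n w @ drop n w" by simp
      ultimately show ?thesis by blast
    qed
  next
    fix w assume "w \<in> {c @ z |c z. c \<in> C}"
    then show "w \<in> R" using R by (auto simp: C_def right_ideal_def)
  qed
  ultimately show "finitely_generated R" unfolding finitely_generated_def by blast
qed

section \<open>Isomorphisms of right ideals as partial maps\<close>

text \<open>Stated with \<open>Some\<close>, the condition carries two facts at once: the domain
  absorbs right multiplication, and the map commutes with it.\<close>

definition translation_equivariant :: "('a list \<rightharpoonup> 'a list) \<Rightarrow> bool" where
  "translation_equivariant \<phi> \<longleftrightarrow> (\<forall>x y z. \<phi> x = Some y \<longrightarrow> \<phi> (x @ z) = Some (y @ z))"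

lemma translation_equivariantD:
  "translation_equivariant \<phi> \<Longrightarrow> \<phi> x = Some y \<Longrightarrow> \<phi> (x @ z) = Some (y @ z)"
  by (simp add: translation_equivariant_def)

lemma translation_equivariant_right_ideal:
  assumes "translation_equivariant \<phi>"
  shows "right_ideal (dom \<phi>)" "right_ideal (ran \<phi>)"
  using translation_equivariantD[OF assms] unfolding right_ideal_def ran_def dom_def by blast+

text \<open>Both ideals can be recovered from \<open>\<phi>\<close>, so being an isomorphism becomes
  a property of the partial map alone.\<close>

lemma right_ideal_iso_iff:
  "right_ideal_iso \<phi> R\<^sub>1 R\<^sub>2 \<longleftrightarrow>
    R\<^sub>1 = dom \<phi> \<and> R\<^sub>2 = ran \<phi> \<and> inj_on \<phi> (dom \<phi>) \<and> translation_equivariant \<phi>"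
proof
  assume iso: "right_ideal_iso \<phi> R\<^sub>1 R\<^sub>2"
  then have dom: "R\<^sub>1 = dom \<phi>" and bij: "bij_betw (\<lambda>r. the (\<phi> r)) R\<^sub>1 R\<^sub>2"
    by (auto simp: right_ideal_iso_def)
  have "R\<^sub>2 = ran \<phi>"
    using bij_betw_imp_surj_on[OF bij] by (auto simp: dom ran_def intro: rev_image_eqI)
  moreover have "inj_on \<phi> (dom \<phi>)"
    using bij_betw_imp_inj_on[OF bij] by (auto simp: dom inj_on_def)
  moreover have "translation_equivariant \<phi>"
    unfolding translation_equivariant_def
  proof (intro allI impI)
    fix x y z assume xy: "\<phi> x = Some y"
    then have "x \<in> dom \<phi>" by blast
    then have "x @ z \<in> dom \<phi>" "the (\<phi> (x @ z)) = the (\<phi> x) @ z"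
      using iso dom unfolding right_ideal_iso_def right_ideal_def by blast+
    then show "\<phi> (x @ z) = Some (y @ z)" using xy by auto
  qed
  ultimately show "R\<^sub>1 = dom \<phi> \<and> R\<^sub>2 = ran \<phi> \<and> inj_on \<phi> (dom \<phi>) \<and> translation_equivariant \<phi>"
    using dom by blast
next
  assume "R\<^sub>1 = dom \<phi> \<and> R\<^sub>2 = ran \<phi> \<and> inj_on \<phi> (dom \<phi>) \<and> translation_equivariant \<phi>"
  then have *: "R\<^sub>1 = dom \<phi>" "R\<^sub>2 = ran \<phi>" "inj_on \<phi> (dom \<phi>)" "translation_equivariant \<phi>"
    by auto
  have "inj_on (\<lambda>r. the (\<phi> r)) (dom \<phi>)"
    using *(3) by (auto simp: inj_on_def dom_def)
  moreover have "(\<lambda>r. the (\<phi> r)) ` dom \<phi> = ran \<phi>"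
    by (auto simp: ran_def intro: rev_image_eqI)
  ultimately have "bij_betw (\<lambda>r. the (\<phi> r)) (dom \<phi>) (ran \<phi>)"
    by (simp add: bij_betw_def)
  moreover have "the (\<phi> (r @ z)) = the (\<phi> r) @ z" if "r \<in> dom \<phi>" for r z
  proof -
    obtain y where y: "\<phi> r = Some y" using \<open>r \<in> dom \<phi>\<close> by blast
    show ?thesis using translation_equivariantD[OF *(4) y, of z] y by simp
  qed
  ultimately show "right_ideal_iso \<phi> R\<^sub>1 R\<^sub>2"
    using translation_equivariant_right_ideal[OF *(4)]
    unfolding right_ideal_iso_def *(1,2) by blast
qed

lemma essential_iso_iff:
  "essential_iso \<phi> \<longleftrightarrow> translation_equivariant \<phi> \<and> inj_on \<phi> (dom \<phi>) \<and>
    (\<forall>w. \<exists>z. w @ z \<in> dom \<phi>) \<and> (\<forall>w. \<exists>z. w @ z \<in> ran \<phi>)"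
  using translation_equivariant_right_ideal[of \<phi>]
  by (auto simp: essential_iso_def right_ideal_iso_iff essential_right_ideal_iff)

lemma fg_essential_iso_iff:
  fixes \<phi> :: "'a::finite list \<rightharpoonup> 'a list"
  shows "fg_essential_iso \<phi> \<longleftrightarrow> translation_equivariant \<phi> \<and> inj_on \<phi> (dom \<phi>) \<and>
    (\<exists>n. \<forall>w. n \<le> length w \<longrightarrow> w \<in> dom \<phi>) \<and> (\<exists>n. \<forall>w. n \<le> length w \<longrightarrow> w \<in> ran \<phi>)"
proof -
  have "fg_essential_iso \<phi> \<longleftrightarrow> (essential_right_ideal (dom \<phi>) \<and> finitely_generated (dom \<phi>)) \<and>
     (essential_right_ideal (ran \<phi>) \<and> finitely_generated (ran \<phi>)) \<and>
     inj_on \<phi> (dom \<phi>) \<and> translation_equivariant \<phi>"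
    by (auto simp: fg_essential_iso_def right_ideal_iso_iff)
  then show ?thesis
    using translation_equivariant_right_ideal[of \<phi>] unfolding fg_essential_right_ideal_iff by blast
qed

lemma fg_essential_imp_essential: "fg_essential_iso \<phi> \<Longrightarrow> essential_iso \<phi>"
  unfolding fg_essential_iso_def essential_iso_def by blast

section \<open>Maximal extensions\<close>

text \<open>An explicit candidate for the maximal extension that \<open>max_extension\<close>
  describes by \<open>THE\<close>. The condition on \<open>y\<close> would hold vacuously at an
  \<open>x\<close> for which no \<open>x @ z\<close> lies in the domain; essentiality rules this
  out.\<close>

definition germ_extension :: "('a list \<rightharpoonup> 'a list) \<Rightarrow> ('a list \<rightharpoonup> 'a list)" where
  "germ_extension \<phi> x =
    (if \<exists>y. \<forall>z v. \<phi> (x @ z) = Some v \<longrightarrow> v = y @ z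
     then Some (SOME y. \<forall>z v. \<phi> (x @ z) = Some v \<longrightarrow> v = y @ z) else None)"

text \<open>An essential domain contains some \<open>x @ z\<close>, and cancelling \<open>z\<close>
  in the value there leaves at most one \<open>y\<close>; so the choice by \<open>SOME\<close> is
  harmless.\<close>

lemma germ_extension_eq_Some_iff:
  assumes "essential_iso \<phi>"
  shows "germ_extension \<phi> x = Some y \<longleftrightarrow> (\<forall>z v. \<phi> (x @ z) = Some v \<longrightarrow> v = y @ z)"
proof -
  obtain z v where zv: "\<phi> (x @ z) = Some v"
    using assms unfolding essential_iso_iff by blast
  have uniq: "y = y'" if "\<forall>z v. \<phi> (x @ z) = Some v \<longrightarrow> v = y @ z"
      "\<forall>z v. \<phi> (x @ z) = Some v \<longrightarrow> v = y' @ z" for y y'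
    using that zv by (metis append_same_eq)
  show ?thesis
  proof (cases "\<exists>y. \<forall>z v. \<phi> (x @ z) = Some v \<longrightarrow> v = y @ z")
    case True
    from someI_ex[OF this] True show ?thesis
      unfolding germ_extension_def using uniq by auto
  qed (auto simp: germ_extension_def)
qed

text \<open>A value \<open>\<psi> x = Some y\<close> forces \<open>y @ z\<close> as the value at
  every \<open>x @ z\<close>, which is the condition that \<open>germ_extension\<close> tests. One
  map thus bounds all extensions of \<open>\<phi>\<close> at once, which yields existence and
  uniqueness of the maximal one.\<close>

lemma map_le_germ_extension:
  assumes \<phi>: "essential_iso \<phi>" and \<psi>: "essential_iso \<psi>" and le: "\<phi> \<subseteq>\<^sub>m \<psi>"
  shows "\<psi> \<subseteq>\<^sub>m germ_extension \<phi>"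
proof -
  have "germ_extension \<phi> x = Some y" if "\<psi> x = Some y" for x y
    unfolding germ_extension_eq_Some_iff[OF \<phi>]
  proof (intro allI impI)
    fix z v assume "\<phi> (x @ z) = Some v"
    then have "\<psi> (x @ z) = Some v" using le by (auto simp: map_le_def dom_def)
    moreover have "\<psi> (x @ z) = Some (y @ z)"
      using \<psi> that unfolding essential_iso_iff by (blast intro: translation_equivariantD)
    ultimately show "v = y @ z" by simp
  qed
  then show ?thesis by (auto simp: map_le_def)
qed

text \<open>Injectivity is the only delicate point: if \<open>x\<close> and \<open>x'\<close> go to
  the same \<open>y\<close>, a common suffix moves both into \<open>dom \<phi>\<close>, where their
  values agree, and cancelling the suffix gives \<open>x = x'\<close>.\<close>

lemma essential_iso_germ_extension:
  assumes \<phi>: "essential_iso \<phi>"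
  shows "essential_iso (germ_extension \<phi>)"
proof -
  note iff = germ_extension_eq_Some_iff[OF \<phi>]
  have le: "\<phi> \<subseteq>\<^sub>m germ_extension \<phi>"
    using map_le_germ_extension[OF \<phi> \<phi>] by simp
  then have "dom \<phi> \<subseteq> dom (germ_extension \<phi>)" "ran \<phi> \<subseteq> ran (germ_extension \<phi>)"
    by (rule map_le_implies_dom_le, rule ran_mono_map_le)
  then have "\<exists>z. w @ z \<in> dom (germ_extension \<phi>)" "\<exists>z. w @ z \<in> ran (germ_extension \<phi>)" for w
    using \<phi> unfolding essential_iso_iff by blast+
  moreover have "translation_equivariant (germ_extension \<phi>)"
    by (simp add: translation_equivariant_def iff)
  moreover have "x = x'"
    if "germ_extension \<phi> x = Some y" "germ_extension \<phi> x' = Some y" for x x' y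
  proof -
    have eq: "\<phi> (x @ z) = Some v \<Longrightarrow> v = y @ z" "\<phi> (x' @ z) = Some v \<Longrightarrow> v = y @ z" for z v
      using that unfolding iff by auto
    obtain z where "x @ z \<in> dom \<phi>" using \<phi> unfolding essential_iso_iff by blast
    \<comment> \<open>\<open>z'\<close> prolongs \<open>x' @ z\<close> rather than
      \<open>x'\<close>, so that the one suffix \<open>z @ z'\<close> serves both words;
      \<open>x @ z\<close> stays in the domain when \<open>z'\<close> is appended.\<close>
    moreover obtain z' where "(x' @ z) @ z' \<in> dom \<phi>" using \<phi> unfolding essential_iso_iff by blast
    ultimately have "x @ z @ z' \<in> dom \<phi>" "x' @ z @ z' \<in> dom \<phi>"
      using \<phi> translation_equivariantD[of \<phi> "x @ z" _ z'] unfolding essential_iso_iff by auto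
    moreover from this have "\<phi> (x @ z @ z') = \<phi> (x' @ z @ z')"
      using eq by (metis domD)
    ultimately have "x @ z @ z' = x' @ z @ z'"
      using \<phi> unfolding essential_iso_iff inj_on_def by blast
    then show ?thesis by simp
  qed
  then have "inj_on (germ_extension \<phi>) (dom (germ_extension \<phi>))"
    by (auto simp: inj_on_def)
  ultimately show ?thesis unfolding essential_iso_iff by blast
qed

lemma max_extension_unique:
  assumes \<phi>: "essential_iso \<phi>" and \<psi>: "maximally_extended \<psi>" and le: "\<phi> \<subseteq>\<^sub>m \<psi>"
  shows "germ_extension \<phi> = \<psi>"
  using map_le_germ_extension[OF \<phi> _ le] essential_iso_germ_extension[OF \<phi>] \<psi>
  unfolding maximally_extended_def by blast

lemma maximally_extended_germ_extension:
  assumes \<phi>: "essential_iso \<phi>"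
  shows "maximally_extended (germ_extension \<phi>)"
  unfolding maximally_extended_def
proof (intro conjI allI impI; (elim conjE)?)
  show "essential_iso (germ_extension \<phi>)" by (rule essential_iso_germ_extension[OF \<phi>])
  fix \<psi> assume \<psi>: "essential_iso \<psi>" "germ_extension \<phi> \<subseteq>\<^sub>m \<psi>"
  have "\<phi> \<subseteq>\<^sub>m germ_extension \<phi>"
    using map_le_germ_extension[OF \<phi> \<phi>] by simp
  with \<psi>(2) have "\<phi> \<subseteq>\<^sub>m \<psi>" by (rule map_le_trans[rotated])
  with \<psi> show "\<psi> = germ_extension \<phi>"
    by (intro map_le_antisym map_le_germ_extension \<phi>)
qed

lemma max_extension_eq_germ_extension:
  assumes "essential_iso \<phi>"
  shows "max_extension \<phi> = germ_extension \<phi>"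
  unfolding max_extension_def
proof (intro the_equality conjI)
  show "maximally_extended (germ_extension \<phi>)" "\<phi> \<subseteq>\<^sub>m germ_extension \<phi>"
    using maximally_extended_germ_extension[OF assms] map_le_germ_extension[OF assms assms] by simp_all
  show "\<psi> = germ_extension \<phi>" if "maximally_extended \<psi> \<and> \<phi> \<subseteq>\<^sub>m \<psi>" for \<psi>
    using max_extension_unique[OF assms] that by blast
qed

lemma
  assumes "essential_iso \<phi>"
  shows maximally_extended_max_extension: "maximally_extended (max_extension \<phi>)"
    and map_le_max_extension: "\<phi> \<subseteq>\<^sub>m max_extension \<phi>"
  using maximally_extended_germ_extension[OF assms] map_le_germ_extension[OF assms assms]
  by (simp_all add: max_extension_eq_germ_extension[OF assms])

lemma max_extension_eqI:
  "essential_iso \<phi> \<Longrightarrow> maximally_extended \<psi> \<Longrightarrow> \<phi> \<subseteq>\<^sub>m \<psi> \<Longrightarrow> max_extension \<phi> = \<psi>"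
  by (simp add: max_extension_eq_germ_extension max_extension_unique)

text \<open>The maximal extension of \<open>\<psi>\<close> also extends \<open>\<phi>\<close>. A
  group element may therefore be represented by any convenient essential restriction.\<close>

lemma max_extension_restrict:
  assumes "essential_iso \<phi>" "essential_iso \<psi>" "\<phi> \<subseteq>\<^sub>m \<psi>"
  shows "max_extension \<phi> = max_extension \<psi>"
  using assms map_le_trans[OF assms(3) map_le_max_extension]
  by (intro max_extension_eqI maximally_extended_max_extension)

lemma essential_iso_max_extension: "essential_iso \<phi> \<Longrightarrow> essential_iso (max_extension \<phi>)"
  using maximally_extended_max_extension unfolding maximally_extended_def by blast

lemma fg_essential_iso_max_extension:
  fixes \<phi> :: "'a::finite list \<rightharpoonup> 'a list"
  assumes "fg_essential_iso \<phi>"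
  shows "fg_essential_iso (max_extension \<phi>)"
proof -
  have ess: "essential_iso \<phi>" by (rule fg_essential_imp_essential[OF assms])
  have "dom \<phi> \<subseteq> dom (max_extension \<phi>)" "ran \<phi> \<subseteq> ran (max_extension \<phi>)"
    using map_le_max_extension[OF ess] by (rule map_le_implies_dom_le, rule ran_mono_map_le)
  then show ?thesis
    using assms essential_iso_max_extension[OF ess]
    unfolding essential_iso_iff fg_essential_iso_iff by blast
qed

section \<open>The Thompson-Higman group\<close>

lemma map_comp_assoc: "(\<phi> \<circ>\<^sub>m \<psi>) \<circ>\<^sub>m \<chi> = \<phi> \<circ>\<^sub>m (\<psi> \<circ>\<^sub>m \<chi>)"
  by (rule ext) (simp add: map_comp_def split: option.split)

lemma map_comp_mono: "\<phi> \<subseteq>\<^sub>m \<phi>' \<Longrightarrow> \<psi> \<subseteq>\<^sub>m \<psi>' \<Longrightarrow> \<phi> \<circ>\<^sub>m \<psi> \<subseteq>\<^sub>m \<phi>' \<circ>\<^sub>m \<psi>'"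
  by (force simp: map_le_def map_comp_def dom_def split: option.splits)

text \<open>The thresholds add up: enough letters to enter the domain (or range) of one map, then
  enough further letters for the other.\<close>

lemma fg_essential_iso_comp:
  fixes \<phi> \<psi> :: "'a::finite list \<rightharpoonup> 'a list"
  assumes \<phi>: "fg_essential_iso \<phi>" and \<psi>: "fg_essential_iso \<psi>"
  shows "fg_essential_iso (\<phi> \<circ>\<^sub>m \<psi>)"
proof -
  have eq: "translation_equivariant \<phi>" "translation_equivariant \<psi>"
    and inj: "inj_on \<phi> (dom \<phi>)" "inj_on \<psi> (dom \<psi>)"
    using \<phi> \<psi> unfolding fg_essential_iso_iff by auto
  obtain m m' where
    m: "\<And>w. m \<le> length w \<Longrightarrow> w \<in> dom \<phi>" and m': "\<And>w. m' \<le> length w \<Longrightarrow> w \<in> ran \<phi>"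
    using \<phi> unfolding fg_essential_iso_iff by blast
  obtain n n' where
    n: "\<And>w. n \<le> length w \<Longrightarrow> w \<in> dom \<psi>" and n': "\<And>w. n' \<le> length w \<Longrightarrow> w \<in> ran \<psi>"
    using \<psi> unfolding fg_essential_iso_iff by blast
  have "translation_equivariant (\<phi> \<circ>\<^sub>m \<psi>)"
    using eq by (auto simp: translation_equivariant_def map_comp_Some_iff)
  moreover have "inj_on (\<phi> \<circ>\<^sub>m \<psi>) (dom (\<phi> \<circ>\<^sub>m \<psi>))"
    using inj by (auto simp: inj_on_def map_comp_Some_iff dom_def)
  moreover have "w \<in> dom (\<phi> \<circ>\<^sub>m \<psi>)" if w: "n + m \<le> length w" for w
  proof -
    obtain v where "\<psi> (take n w) = Some v" using n[of "take n w"] w by auto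
    then have "\<psi> w = Some (v @ drop n w)"
      using translation_equivariantD[OF eq(2), of "take n w" v "drop n w"] by simp
    \<comment> \<open>No lower bound on the length of \<open>v\<close> is available, so the required
      \<open>m\<close> letters must all come from \<open>drop n w\<close>.\<close>
    moreover have "v @ drop n w \<in> dom \<phi>"
      by (rule m) (use w in simp)
    ultimately show ?thesis by (auto simp: map_comp_Some_iff dom_def)
  qed
  moreover have "w \<in> ran (\<phi> \<circ>\<^sub>m \<psi>)" if w: "m' + n' \<le> length w" for w
  proof -
    obtain v where "\<phi> v = Some (take m' w)" using m'[of "take m' w"] w by (auto simp: ran_def)
    then have "\<phi> (v @ drop m' w) = Some w"
      using translation_equivariantD[OF eq(1), of v "take m' w" "drop m' w"] by simp
    moreover have "v @ drop m' w \<in> ran \<psi>"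
      by (rule n') (use w in simp)
    ultimately show ?thesis by (auto simp: map_comp_Some_iff ran_def)
  qed
  ultimately show ?thesis unfolding fg_essential_iso_iff by blast
qed

text \<open>Products can be computed on representatives: their composite is a restriction of the
  composite of their maximal extensions. Associativity in the group then reduces to that of
  \<open>\<circ>\<^sub>m\<close>.\<close>

lemma max_extension_comp:
  fixes \<phi> \<psi> :: "'a::finite list \<rightharpoonup> 'a list"
  assumes "fg_essential_iso \<phi>" "fg_essential_iso \<psi>"
  shows "max_extension (max_extension \<phi> \<circ>\<^sub>m max_extension \<psi>) = max_extension (\<phi> \<circ>\<^sub>m \<psi>)"
  by (rule max_extension_restrict[symmetric])
    (intro fg_essential_imp_essential fg_essential_iso_comp fg_essential_iso_max_extension
      map_comp_mono map_le_max_extension assms)+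

lemma max_extension_id:
  "\<phi> \<in> carrier thompson_higman \<Longrightarrow> max_extension \<phi> = \<phi>"
  by (auto simp: thompson_higman_def fg_essential_imp_essential intro!: max_extension_eqI)

lemma max_extension_in_carrier:
  fixes \<phi> :: "'a::finite list \<rightharpoonup> 'a list"
  assumes "fg_essential_iso \<phi>"
  shows "max_extension \<phi> \<in> carrier thompson_higman"
  using assms
  by (simp add: thompson_higman_def fg_essential_iso_max_extension
      maximally_extended_max_extension fg_essential_imp_essential)

lemma fg_essential_iso_Some: "fg_essential_iso (Some :: 'a::finite list \<rightharpoonup> 'a list)"
  unfolding fg_essential_iso_iff by (auto simp: translation_equivariant_def ran_def dom_def)

lemma maximally_extended_Some: "maximally_extended (Some :: 'a::finite list \<rightharpoonup> 'a list)"
  unfolding maximally_extended_def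
  using fg_essential_imp_essential[OF fg_essential_iso_Some]
  by (auto simp: map_le_def dom_def)

section \<open>Inverses and the group axioms\<close>

definition map_inverse :: "('a \<rightharpoonup> 'b) \<Rightarrow> ('b \<rightharpoonup> 'a)" where
  "map_inverse \<phi> y = (if y \<in> ran \<phi> then Some (SOME x. \<phi> x = Some y) else None)"

lemma map_inverse_eq_Some_iff:
  assumes "inj_on \<phi> (dom \<phi>)"
  shows "map_inverse \<phi> y = Some x \<longleftrightarrow> \<phi> x = Some y"
proof
  assume "map_inverse \<phi> y = Some x"
  then show "\<phi> x = Some y"
    by (auto simp: map_inverse_def ran_def split: if_splits intro: someI)
next
  assume x: "\<phi> x = Some y"
  then have "(SOME x. \<phi> x = Some y) = x"
    using assms by (intro some_equality) (auto simp: inj_on_def dom_def)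
  with x show "map_inverse \<phi> y = Some x" by (auto simp: map_inverse_def ran_def)
qed

lemma fg_essential_iso_map_inverse:
  fixes \<phi> :: "'a::finite list \<rightharpoonup> 'a list"
  assumes "fg_essential_iso \<phi>"
  shows "fg_essential_iso (map_inverse \<phi>)"
proof -
  have inj: "inj_on \<phi> (dom \<phi>)" using assms by (simp add: fg_essential_iso_iff)
  note iff = map_inverse_eq_Some_iff[OF inj]
  have "dom (map_inverse \<phi>) = ran \<phi>" "ran (map_inverse \<phi>) = dom \<phi>"
    by (auto simp: dom_def ran_def iff)
  moreover have "inj_on (map_inverse \<phi>) (dom (map_inverse \<phi>))"
    by (auto simp: inj_on_def iff) (metis iff option.inject)
  moreover have "translation_equivariant (map_inverse \<phi>)"
    using assms by (auto simp: fg_essential_iso_iff translation_equivariant_def iff)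
  ultimately show ?thesis using assms by (simp add: fg_essential_iso_iff)
qed

text \<open>The inverse composed with \<open>\<phi>\<close> is a restriction of the identity, whose
  maximal extension is \<open>Some\<close>. Applying \<open>max_extension\<close> to the inverse
  places it in the carrier without a proof that it is already maximal.\<close>

lemma thompson_higman_left_inverse:
  fixes \<phi> :: "'a::finite list \<rightharpoonup> 'a list"
  assumes "\<phi> \<in> carrier thompson_higman"
  shows "max_extension (map_inverse \<phi>) \<otimes>\<^bsub>thompson_higman\<^esub> \<phi> = \<one>\<^bsub>thompson_higman\<^esub>"
proof -
  have fg: "fg_essential_iso \<phi>" using assms by (simp add: thompson_higman_def)
  then have inj: "inj_on \<phi> (dom \<phi>)" by (simp add: fg_essential_iso_iff)
  note inv = fg_essential_iso_map_inverse[OF fg]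
  have "max_extension (map_inverse \<phi>) \<otimes>\<^bsub>thompson_higman\<^esub> \<phi> = max_extension (map_inverse \<phi> \<circ>\<^sub>m \<phi>)"
    using max_extension_comp[OF inv fg] max_extension_id[OF assms] by (simp add: thompson_higman_def)
  also have "\<dots> = Some"
    using maximally_extended_Some fg_essential_imp_essential[OF fg_essential_iso_comp[OF inv fg]]
    by (intro max_extension_eqI)
      (auto simp: map_le_def map_comp_Some_iff map_inverse_eq_Some_iff[OF inj] dom_def)
  finally show ?thesis by (simp add: thompson_higman_def)
qed

lemma group_thompson_higman: "group (thompson_higman :: ('a::finite list \<rightharpoonup> 'a list) monoid)"
proof (rule groupI)
  let ?G = "thompson_higman :: ('a list \<rightharpoonup> 'a list) monoid"
  have fg: "fg_essential_iso \<phi>" if "\<phi> \<in> carrier ?G" for \<phi>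
    using that by (simp add: thompson_higman_def)
  note id = max_extension_id
  fix \<phi> \<psi> \<chi> assume \<phi>: "\<phi> \<in> carrier ?G" and \<psi>: "\<psi> \<in> carrier ?G" and \<chi>: "\<chi> \<in> carrier ?G"
  show "\<phi> \<otimes>\<^bsub>?G\<^esub> \<psi> \<in> carrier ?G"
    using max_extension_in_carrier[OF fg_essential_iso_comp[OF fg[OF \<phi>] fg[OF \<psi>]]]
    by (simp add: thompson_higman_def)
  have "max_extension (max_extension (\<phi> \<circ>\<^sub>m \<psi>) \<circ>\<^sub>m \<chi>) = max_extension (\<phi> \<circ>\<^sub>m max_extension (\<psi> \<circ>\<^sub>m \<chi>))"
    using max_extension_comp[OF fg_essential_iso_comp[OF fg[OF \<phi>] fg[OF \<psi>]] fg[OF \<chi>]]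
      max_extension_comp[OF fg[OF \<phi>] fg_essential_iso_comp[OF fg[OF \<psi>] fg[OF \<chi>]]]
    by (simp add: id[OF \<phi>] id[OF \<chi>] map_comp_assoc)
  then show "\<phi> \<otimes>\<^bsub>?G\<^esub> \<psi> \<otimes>\<^bsub>?G\<^esub> \<chi> = \<phi> \<otimes>\<^bsub>?G\<^esub> (\<psi> \<otimes>\<^bsub>?G\<^esub> \<chi>)"
    by (simp add: thompson_higman_def)
next
  let ?G = "thompson_higman :: ('a list \<rightharpoonup> 'a list) monoid"
  show "\<one>\<^bsub>?G\<^esub> \<in> carrier ?G"
    by (simp add: thompson_higman_def fg_essential_iso_Some maximally_extended_Some)
  fix \<phi> assume \<phi>: "\<phi> \<in> carrier ?G"
  have "Some \<circ>\<^sub>m \<phi> = \<phi>" by (rule ext) (simp add: map_comp_def split: option.split)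
  then show "\<one>\<^bsub>?G\<^esub> \<otimes>\<^bsub>?G\<^esub> \<phi> = \<phi>"
    using max_extension_id[OF \<phi>] by (simp add: thompson_higman_def)
  have "fg_essential_iso \<phi>" using \<phi> by (simp add: thompson_higman_def)
  then show "\<exists>\<psi>\<in>carrier ?G. \<psi> \<otimes>\<^bsub>?G\<^esub> \<phi> = \<one>\<^bsub>?G\<^esub>"
    using thompson_higman_left_inverse[OF \<phi>] fg_essential_iso_map_inverse max_extension_in_carrier
    by blast
qed

section \<open>The length-preserving subgroup\<close>

definition length_preserving :: "('a list \<rightharpoonup> 'a list) \<Rightarrow> bool" where
  "length_preserving \<phi> \<longleftrightarrow> (\<forall>x y. \<phi> x = Some y \<longrightarrow> length x = length y)"

lemma lp_elements_iff:
  "\<phi> \<in> lp_elements \<longleftrightarrow> \<phi> \<in> carrier thompson_higman \<and> length_preserving \<phi>"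
  by (force simp: lp_elements_def length_preserving_def)

text \<open>A suffix \<open>z\<close> that brings \<open>x\<close> into the domain of
  \<open>\<phi>\<close> adds the same length to the word and to its value, so lengths can be
  compared there.\<close>

lemma length_preserving_max_extension:
  assumes \<phi>: "essential_iso \<phi>" and lp: "length_preserving \<phi>"
  shows "length_preserving (max_extension \<phi>)"
  unfolding length_preserving_def
proof (intro allI impI)
  fix x y assume xy: "max_extension \<phi> x = Some y"
  obtain z v where zv: "\<phi> (x @ z) = Some v" using \<phi> unfolding essential_iso_iff by blast
  have "max_extension \<phi> (x @ z) = Some (y @ z)"
    using essential_iso_max_extension[OF \<phi>] xy
    unfolding essential_iso_iff by (blast intro: translation_equivariantD)
  moreover have "max_extension \<phi> (x @ z) = Some v"
    using map_le_max_extension[OF \<phi>] zv by (auto simp: map_le_def dom_def)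
  moreover have "length (x @ z) = length v"
    using lp zv unfolding length_preserving_def by blast
  ultimately show "length x = length y" by simp
qed

lemma max_extension_in_lp:
  fixes \<phi> :: "'a::finite list \<rightharpoonup> 'a list"
  assumes "fg_essential_iso \<phi>" "length_preserving \<phi>"
  shows "max_extension \<phi> \<in> lp_elements"
  using assms
  by (simp add: lp_elements_iff max_extension_in_carrier length_preserving_max_extension
      fg_essential_imp_essential)

lemma subgroup_lp_elements:
  "subgroup lp_elements (thompson_higman :: ('a::finite list \<rightharpoonup> 'a list) monoid)"
proof -
  interpret group "thompson_higman :: ('a list \<rightharpoonup> 'a list) monoid" by (rule group_thompson_higman)
  let ?G = "thompson_higman :: ('a list \<rightharpoonup> 'a list) monoid"
  have fg: "fg_essential_iso \<phi>" "length_preserving \<phi>" "\<phi> \<in> carrier ?G"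
    if "\<phi> \<in> lp_elements" for \<phi> :: "'a list \<rightharpoonup> 'a list"
    using that by (simp_all add: lp_elements_iff thompson_higman_def)
  show ?thesis
  proof (rule subgroupI)
    show "lp_elements \<subseteq> carrier ?G" using fg(3) by blast
    show "(lp_elements :: ('a list \<rightharpoonup> 'a list) set) \<noteq> {}"
      using one_closed
      by (auto simp: lp_elements_iff length_preserving_def thompson_higman_def)
  next
    fix \<phi> :: "'a list \<rightharpoonup> 'a list" assume \<phi>: "\<phi> \<in> lp_elements"
    have "max_extension (map_inverse \<phi>) \<in> lp_elements"
    proof (intro max_extension_in_lp fg_essential_iso_map_inverse fg[OF \<phi>])
      have "inj_on \<phi> (dom \<phi>)" using fg(1)[OF \<phi>] by (simp add: fg_essential_iso_iff)
      from map_inverse_eq_Some_iff[OF this] show "length_preserving (map_inverse \<phi>)"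
        using fg(2)[OF \<phi>] by (simp add: length_preserving_def)
    qed
    moreover have "inv\<^bsub>?G\<^esub> \<phi> = max_extension (map_inverse \<phi>)"
      using fg(3) calculation \<phi> by (intro inv_equality thompson_higman_left_inverse)
    ultimately show "inv\<^bsub>?G\<^esub> \<phi> \<in> lp_elements" by simp
  next
    fix \<phi> \<psi> :: "'a list \<rightharpoonup> 'a list" assume \<phi>: "\<phi> \<in> lp_elements" and \<psi>: "\<psi> \<in> lp_elements"
    have "length_preserving (\<phi> \<circ>\<^sub>m \<psi>)"
      using fg(2)[OF \<phi>] fg(2)[OF \<psi>] by (auto simp: length_preserving_def map_comp_Some_iff)
    then show "\<phi> \<otimes>\<^bsub>?G\<^esub> \<psi> \<in> lp_elements"
      using max_extension_in_lp[OF fg_essential_iso_comp[OF fg(1)[OF \<phi>] fg(1)[OF \<psi>]]]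
      by (simp add: thompson_higman_def)
  qed
qed

section \<open>Direct limits\<close>

lemma shift_cocone:
  assumes "\<And>i x. x \<in> carrier (G i) \<Longrightarrow> f i x \<in> carrier (G (Suc i))"
    and "\<And>i x. x \<in> carrier (G i) \<Longrightarrow> g (Suc i) (f i x) = g i x"
    and "x \<in> carrier (G m)"
  shows "shift f m j x \<in> carrier (G (m + j)) \<and> g (m + j) (shift f m j x) = g m x"
  by (induction j) (use assms in auto)

text \<open>The maps \<open>g i\<close> form a compatible family of injective homomorphisms whose
  images cover \<open>H\<close>. Injectivity makes eventual equality of \<open>(m, x)\<close> and
  \<open>(n, y)\<close> the same as \<open>g m x = g n y\<close>, so the elements of the limit are
  exactly the fibres of the joint map from pairs \<open>(n, x)\<close> to
  \<open>g n x\<close>.\<close>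

lemma direct_limit_iso:
  fixes G :: "nat \<Rightarrow> 'b monoid" and H :: "('c, 'd) monoid_scheme"
  assumes closed: "\<And>i x. x \<in> carrier (G i) \<Longrightarrow> f i x \<in> carrier (G (Suc i))"
    and compat: "\<And>i x. x \<in> carrier (G i) \<Longrightarrow> g (Suc i) (f i x) = g i x"
    and mult: "\<And>i x y. x \<in> carrier (G i) \<Longrightarrow> y \<in> carrier (G i) \<Longrightarrow> x \<otimes>\<^bsub>G i\<^esub> y \<in> carrier (G i)"
    and hom: "\<And>i. g i \<in> hom (G i) H"
    and inj: "\<And>i. inj_on (g i) (carrier (G i))"
    and surj: "\<And>h. h \<in> carrier H \<Longrightarrow> \<exists>i. \<exists>x\<in>carrier (G i). g i x = h"
  shows "H \<cong> direct_limit G f"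
proof -
  \<comment> \<open>The isomorphism runs from \<open>H\<close> to the limit: an element of
    \<open>H\<close> goes to the set of all its representatives, at every level.\<close>
  define fib where "fib h = {(n, x). x \<in> carrier (G n) \<and> g n x = h}" for h
  have sh: "shift f m j x \<in> carrier (G (m + j))" "g (m + j) (shift f m j x) = g m x"
    if "x \<in> carrier (G m)" for m j x
    using shift_cocone[of G f g, OF closed compat that] by auto
  have rel: "((m, x), (n, y)) \<in> limit_rel G f \<longleftrightarrow>
    x \<in> carrier (G m) \<and> y \<in> carrier (G n) \<and> g m x = g n y" for m x n y
  proof
    assume "((m, x), (n, y)) \<in> limit_rel G f"
    then obtain i j where "x \<in> carrier (G m)" "y \<in> carrier (G n)" "m + i = n + j"
        "shift f m i x = shift f n j y"
      by (auto simp: limit_rel_def)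
    then show "x \<in> carrier (G m) \<and> y \<in> carrier (G n) \<and> g m x = g n y"
      by (metis sh(2))
  next
    assume *: "x \<in> carrier (G m) \<and> y \<in> carrier (G n) \<and> g m x = g n y"
    \<comment> \<open>Both elements are pushed to the common level \<open>m + n\<close>, where
      injectivity of \<open>g (m + n)\<close> identifies them.\<close>
    then have "shift f m n x = shift f n m y"
      using sh[of x m n] sh[of y n m] inj[of "m + n"] by (simp add: inj_on_def add.commute)
    with * show "((m, x), (n, y)) \<in> limit_rel G f"
      unfolding limit_rel_def by (auto intro: exI[of _ n] exI[of _ m])
  qed
  have cls: "limit_rel G f `` {(m, x)} = fib (g m x)" if "x \<in> carrier (G m)" for m x
    using that by (auto simp: fib_def rel)
  have gc: "g m x \<in> carrier H" if "x \<in> carrier (G m)" for m x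
    using hom that by (auto simp: hom_def)
  have "fib ` carrier H = (SIGMA n:UNIV. carrier (G n)) // limit_rel G f"
  proof (intro equalityI subsetI)
    fix X assume "X \<in> fib ` carrier H"
    then obtain n x where "x \<in> carrier (G n)" "X = limit_rel G f `` {(n, x)}"
      using surj cls by force
    then show "X \<in> (SIGMA n:UNIV. carrier (G n)) // limit_rel G f"
      by (auto intro: quotientI)
  next
    fix X assume "X \<in> (SIGMA n:UNIV. carrier (G n)) // limit_rel G f"
    then show "X \<in> fib ` carrier H"
      by (auto elim!: quotientE simp: cls gc)
  qed
  moreover have "inj_on fib (carrier H)"
  proof (rule inj_onI)
    fix h h' assume h: "h \<in> carrier H" and eq: "fib h = fib h'"
    obtain n x where "(n, x) \<in> fib h" using surj[OF h] by (auto simp: fib_def)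
    with eq have "(n, x) \<in> fib h" "(n, x) \<in> fib h'" by auto
    then show "h = h'" by (auto simp: fib_def)
  qed
  moreover have "fib (h \<otimes>\<^bsub>H\<^esub> h') = fib h \<otimes>\<^bsub>direct_limit G f\<^esub> fib h'"
    if h: "h \<in> carrier H" and h': "h' \<in> carrier H" for h h'
  proof -
    have "limit_rel G f `` {(m + n, shift f m n x \<otimes>\<^bsub>G (m + n)\<^esub> shift f n m y)} = fib (h \<otimes>\<^bsub>H\<^esub> h')"
      if "(m, x) \<in> fib h" "(n, y) \<in> fib h'" for m n x y
    proof -
      have "shift f m n x \<in> carrier (G (m + n))" "shift f n m y \<in> carrier (G (m + n))"
        "g (m + n) (shift f m n x) = h" "g (m + n) (shift f n m y) = h'"
        using that sh[of x m n] sh[of y n m] by (auto simp: fib_def add.commute)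
      then show ?thesis
        using cls mult hom[of "m + n"] by (simp add: hom_def)
    qed
    \<comment> \<open>The product in the limit is a union over representatives. All the sets united
      are the same class, and non-emptiness of both fibres keeps the union from being empty.\<close>
    moreover have "fib h \<noteq> {}" "fib h' \<noteq> {}"
      using surj[OF h] surj[OF h'] by (auto simp: fib_def)
    ultimately show ?thesis
      by (fastforce simp: direct_limit_def)
  qed
  ultimately have "fib \<in> iso H (direct_limit G f)"
    by (auto simp: iso_def hom_def bij_betw_def direct_limit_def)
  then show ?thesis unfolding is_iso_def by blast
qed

section \<open>Permutations of words\<close>

text \<open>The words of length \<open>n\<close> form a maximal prefix code; for a permutation of
  this code, this is the isomorphism of right ideals that it represents.\<close>

definition prefix_map :: "nat \<Rightarrow> ('a list \<Rightarrow> 'a list) \<Rightarrow> ('a list \<rightharpoonup> 'a list)" where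
  "prefix_map n \<pi> w = (if n \<le> length w then Some (\<pi> (take n w) @ drop n w) else None)"

lemma finite_words: "finite (words n :: 'a::finite list set)"
  using finite_lists_length_eq[of "UNIV :: 'a set" n] by (simp add: words_def)

text \<open>Words outside \<open>words n\<close> are fixed, so lengths agree for every
  \<open>w\<close>. This is what lets words be split again at the right place after a permutation
  has acted on a prefix.\<close>

lemma length_permutes_words:
  "\<pi> permutes words n \<Longrightarrow> length (\<pi> w) = length w"
  by (cases "length w = n")
    (use permutes_in_image[of \<pi> "words n" w] permutes_not_in[of \<pi> "words n" w] in
      \<open>auto simp: words_def\<close>)

lemma length_preserving_prefix_map:
  "\<pi> permutes words n \<Longrightarrow> length_preserving (prefix_map n \<pi>)"
  by (auto simp: length_preserving_def prefix_map_def length_permutes_words split: if_splits)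

lemma prefix_map_comp:
  "\<sigma> permutes words n \<Longrightarrow> prefix_map n (\<pi> \<circ> \<sigma>) = prefix_map n \<pi> \<circ>\<^sub>m prefix_map n \<sigma>"
  by (rule ext) (simp add: prefix_map_def map_comp_def length_permutes_words)

lemma fg_essential_iso_prefix_map:
  fixes \<pi> :: "'a::finite list \<Rightarrow> 'a list"
  assumes \<pi>: "\<pi> permutes words n"
  shows "fg_essential_iso (prefix_map n \<pi>)"
proof -
  have "inj_on (prefix_map n \<pi>) (dom (prefix_map n \<pi>))"
  proof (rule inj_onI)
    fix v w assume "v \<in> dom (prefix_map n \<pi>)" "w \<in> dom (prefix_map n \<pi>)"
      "prefix_map n \<pi> v = prefix_map n \<pi> w"
    then have "n \<le> length v" "n \<le> length w"
      "\<pi> (take n v) @ drop n v = \<pi> (take n w) @ drop n w"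
      by (auto simp: prefix_map_def split: if_splits)
    then have "\<pi> (take n v) = \<pi> (take n w)" "drop n v = drop n w"
      by (auto simp: length_permutes_words[OF \<pi>])
    then have "take n v = take n w" "drop n v = drop n w"
      using permutes_inj[OF \<pi>] by (auto dest: injD)
    then show "v = w" by (metis append_take_drop_id)
  qed
  moreover have "w \<in> ran (prefix_map n \<pi>)" if "n \<le> length w" for w
  proof -
    obtain u where u: "\<pi> u = take n w" using permutes_surj[OF \<pi>] by (metis surjD)
    then have "length u = n" using length_permutes_words[OF \<pi>, of u] that by simp
    then have "prefix_map n \<pi> (u @ drop n w) = Some w" using u by (simp add: prefix_map_def)
    then show ?thesis by (auto simp: ran_def)
  qed
  moreover have "w \<in> dom (prefix_map n \<pi>)" if "n \<le> length w" for w
    using that by (simp add: prefix_map_def dom_def)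
  moreover have "translation_equivariant (prefix_map n \<pi>)"
    by (auto simp: translation_equivariant_def prefix_map_def split: if_splits)
  ultimately show ?thesis unfolding fg_essential_iso_iff by blast
qed

text \<open>On \<open>words n\<close> the maximal extension still takes the values of the
  permutation, and off \<open>words n\<close> both permutations are the identity.\<close>

lemma max_extension_prefix_map_inj:
  fixes \<pi> \<sigma> :: "'a::finite list \<Rightarrow> 'a list"
  assumes \<pi>: "\<pi> permutes words n" and \<sigma>: "\<sigma> permutes words n"
    and eq: "max_extension (prefix_map n \<pi>) = max_extension (prefix_map n \<sigma>)"
  shows "\<pi> = \<sigma>"
proof
  fix w
  show "\<pi> w = \<sigma> w"
  proof (cases "w \<in> words n")
    case True
    have "max_extension (prefix_map n \<tau>) w = Some (\<tau> w)" if "\<tau> permutes words n" for \<tau>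
      using map_le_max_extension[OF fg_essential_imp_essential[OF fg_essential_iso_prefix_map[OF that]]] True
      by (auto simp: map_le_def prefix_map_def dom_def words_def)
    from this[OF \<pi>] this[OF \<sigma>] eq show ?thesis by simp
  next
    case False
    then show ?thesis using permutes_not_in[OF \<pi>] permutes_not_in[OF \<sigma>] by simp
  qed
qed

text \<open>For large \<open>n\<close>, \<open>\<phi>\<close> is defined on all of
  \<open>words n\<close> and maps it injectively into itself by preservation of length, hence
  bijectively by finiteness. The resulting \<open>prefix_map\<close> is a restriction of
  \<open>\<phi>\<close>, so \<open>\<phi>\<close> is its maximal extension.\<close>

lemma lp_elements_prefix_map:
  fixes \<phi> :: "'a::finite list \<rightharpoonup> 'a list"
  assumes \<phi>: "\<phi> \<in> lp_elements"
  obtains n \<pi> where "n \<ge> 1" "\<pi> permutes words n" "max_extension (prefix_map n \<pi>) = \<phi>"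
proof -
  have fg: "fg_essential_iso \<phi>" and lp: "length_preserving \<phi>" and car: "\<phi> \<in> carrier thompson_higman"
    using \<phi> by (auto simp: lp_elements_iff thompson_higman_def)
  obtain n0 where n0: "\<And>w. n0 \<le> length w \<Longrightarrow> w \<in> dom \<phi>"
    using fg unfolding fg_essential_iso_iff by blast
  \<comment> \<open>The successor guarantees \<open>n \<ge> 1\<close>, as the limit starts with
    words of length one.\<close>
  define n where "n = Suc n0"
  define \<pi> where "\<pi> w = (if w \<in> words n then the (\<phi> w) else w)" for w
  have val: "\<phi> w = Some (\<pi> w)" if "w \<in> words n" for w
    using that n0[of w] by (auto simp: \<pi>_def words_def n_def)
  have maps: "\<pi> ` words n \<subseteq> words n"
  proof
    fix v assume "v \<in> \<pi> ` words n"
    then obtain w where w: "w \<in> words n" "v = \<pi> w" by blast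
    have "length w = length (\<pi> w)"
      using lp val[OF w(1)] unfolding length_preserving_def by blast
    with w show "v \<in> words n" by (simp add: words_def)
  qed
  have "inj_on \<pi> (words n)"
  proof (rule inj_onI)
    fix v w assume *: "v \<in> words n" "w \<in> words n" "\<pi> v = \<pi> w"
    with val have "\<phi> v = \<phi> w" "v \<in> dom \<phi>" "w \<in> dom \<phi>" by (auto simp: dom_def)
    then show "v = w" using fg unfolding fg_essential_iso_iff inj_on_def by blast
  qed
  with maps have "bij_betw \<pi> (words n) (words n)"
    using endo_inj_surj[OF finite_words maps] by (simp add: bij_betw_def)
  then have perm: "\<pi> permutes words n"
    by (rule bij_imp_permutes) (simp add: \<pi>_def)
  have "prefix_map n \<pi> \<subseteq>\<^sub>m \<phi>"
  proof -
    have "\<phi> w = Some (\<pi> (take n w) @ drop n w)" if "n \<le> length w" for w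
    proof -
      have "\<phi> (take n w @ drop n w) = Some (\<pi> (take n w) @ drop n w)"
        using fg val[of "take n w"] that
        by (intro translation_equivariantD) (auto simp: fg_essential_iso_iff words_def)
      then show ?thesis by simp
    qed
    then show ?thesis by (auto simp: map_le_def prefix_map_def split: if_splits)
  qed
  then have "max_extension (prefix_map n \<pi>) = \<phi>"
    using fg_essential_imp_essential[OF fg_essential_iso_prefix_map[OF perm]] car
    by (intro max_extension_eqI) (auto simp: thompson_higman_def)
  with perm show ?thesis by (intro that[of n \<pi>]) (simp_all add: n_def)
qed

section \<open>The diagonal embeddings\<close>

lemma tensor_id_id: "tensor_id n id = id"
  by (rule ext) (auto simp: tensor_id_def words_def length_Suc_conv_rev)

lemma tensor_id_comp:
  assumes "\<sigma> permutes words n"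
  shows "tensor_id n (\<pi> \<circ> \<sigma>) = tensor_id n \<pi> \<circ> tensor_id n \<sigma>"
  by (rule ext) (auto simp: tensor_id_def words_def length_permutes_words[OF assms])

text \<open>By multiplicativity, the tensor of the inverse permutation is a two-sided
  inverse.\<close>

lemma tensor_id_permutes:
  fixes \<pi> :: "'a list \<Rightarrow> 'a list"
  assumes "\<pi> permutes words n"
  shows "tensor_id n \<pi> permutes words (Suc n)"
proof (rule bij_imp_permutes)
  have inv: "inv_into UNIV \<pi> permutes words n" by (rule permutes_inv[OF assms])
  have comp: "tensor_id n \<pi> \<circ> tensor_id n (inv_into UNIV \<pi>) = id"
    "tensor_id n (inv_into UNIV \<pi>) \<circ> tensor_id n \<pi> = id"
    using tensor_id_comp[OF inv, of \<pi>] tensor_id_comp[OF assms, of "inv_into UNIV \<pi>"]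
      permutes_inv_o[OF assms]
    by (simp_all add: tensor_id_id)
  have "tensor_id n \<tau> w \<in> words (Suc n)" if "\<tau> permutes words n" "w \<in> words (Suc n)"
    for \<tau> :: "'a list \<Rightarrow> 'a list" and w
    using that by (auto simp: tensor_id_def words_def length_permutes_words)
  then show "bij_betw (tensor_id n \<pi>) (words (Suc n)) (words (Suc n))"
    using comp assms inv
    by (intro bij_betw_byWitness[where f' = "tensor_id n (inv_into UNIV \<pi>)"])
      (auto simp: fun_eq_iff)
  show "tensor_id n \<pi> w = w" if "w \<notin> words (Suc n)" for w
    using that by (simp add: tensor_id_def)
qed

lemma tensor_id_mon:
  "tensor_id n \<in> mon (sym_group_on (words n :: 'a list set)) (sym_group_on (words (n + 1)))"
proof -
  have "inj_on (tensor_id n) {\<pi>. \<pi> permutes (words n :: 'a list set)}"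
  proof (intro inj_onI ext)
    fix \<pi> \<sigma> :: "'a list \<Rightarrow> 'a list" and w
    assume *: "\<pi> \<in> {\<pi>. \<pi> permutes words n}" "\<sigma> \<in> {\<pi>. \<pi> permutes words n}"
      "tensor_id n \<pi> = tensor_id n \<sigma>"
    show "\<pi> w = \<sigma> w"
    proof (cases "w \<in> words n")
      case True
      \<comment> \<open>Any letter may be appended: the value at the longer word determines the
        value at \<open>w\<close>.\<close>
      have "tensor_id n \<pi> (w @ [undefined]) = tensor_id n \<sigma> (w @ [undefined])" using * by simp
      with True show ?thesis by (simp add: tensor_id_def words_def)
    next
      case False
      with * show ?thesis by (simp add: permutes_not_in)
    qed
  qed
  then show ?thesis
    by (auto simp: mon_def hom_def sym_group_on_def tensor_id_permutes tensor_id_comp)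
qed

text \<open>\<open>tensor_id n \<pi>\<close> leaves the letter after the first \<open>n\<close> in
  place, so it induces just \<open>prefix_map n \<pi>\<close> restricted to words of length at least
  \<open>n + 1\<close>. This makes the maps into the Thompson-Higman group compatible with the
  connecting maps.\<close>

lemma max_extension_prefix_map_tensor_id:
  fixes \<pi> :: "'a::finite list \<Rightarrow> 'a list"
  assumes \<pi>: "\<pi> permutes words n"
  shows "max_extension (prefix_map (Suc n) (tensor_id n \<pi>)) = max_extension (prefix_map n \<pi>)"
proof (rule max_extension_restrict)
  show "essential_iso (prefix_map (Suc n) (tensor_id n \<pi>))" "essential_iso (prefix_map n \<pi>)"
    by (intro fg_essential_imp_essential fg_essential_iso_prefix_map tensor_id_permutes \<pi>)+
  show "prefix_map (Suc n) (tensor_id n \<pi>) \<subseteq>\<^sub>m prefix_map n \<pi>"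
    by (auto simp: map_le_def prefix_map_def tensor_id_def words_def take_Suc_conv_app_nth
        Cons_nth_drop_Suc split: if_splits)
qed

section \<open>Parity of the diagonal embeddings\<close>

lemma evenperm_tensor_id_transpose:
  fixes x y :: "'a::finite list"
  assumes "x \<in> words n" "y \<in> words n" "x \<noteq> y"
  shows "evenperm (tensor_id n (transpose x y)) \<longleftrightarrow> even CARD('a)"
proof -
  \<comment> \<open>\<open>\<tau> S\<close> interpolates between the identity, at the empty set, and
    \<open>tensor_id n (transpose x y)\<close>, at \<open>UNIV\<close>; each new letter
    \<open>a\<close> multiplies it by the one transposition of \<open>x @ [a]\<close> and
    \<open>y @ [a]\<close>.\<close>
  define \<tau> where "\<tau> S w =
    (if w \<in> words (Suc n) \<and> last w \<in> S then transpose x y (butlast w) @ [last w] else w)"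
    for S :: "'a set" and w
  \<comment> \<open>Finite support travels with the parity claim through the induction, since
    \<open>evenperm_comp\<close> asks for it.\<close>
  have "permutation (\<tau> S) \<and> (evenperm (\<tau> S) \<longleftrightarrow> even (card S))" if "finite S" for S
    using that
  proof (induction S)
    case empty
    have "\<tau> {} = id" by (rule ext) (simp add: \<tau>_def)
    then show ?case by simp
  next
    case (insert a S)
    have "\<tau> (insert a S) w = (transpose (x @ [a]) (y @ [a]) \<circ> \<tau> S) w" for w
    proof (cases w rule: rev_cases)
      case (snoc u b)
      then show ?thesis
        using insert(2) assms
        by (auto simp: \<tau>_def words_def transpose_def)
    qed (simp add: \<tau>_def words_def transpose_def)
    then have *: "\<tau> (insert a S) = transpose (x @ [a]) (y @ [a]) \<circ> \<tau> S" by blast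
    have IH: "permutation (\<tau> S)" "evenperm (\<tau> S) \<longleftrightarrow> even (card S)"
      using insert by auto
    have "permutation (\<tau> (insert a S))"
      unfolding * by (rule permutation_compose[OF permutation_swap_id IH(1)])
    \<comment> \<open>Because \<open>x \<noteq> y\<close>, the new factor is a genuine
      transposition, so the parity flips together with that of the cardinality.\<close>
    moreover have "evenperm (\<tau> (insert a S)) \<longleftrightarrow> even (card (insert a S))"
      unfolding * evenperm_comp[OF permutation_swap_id IH(1)] evenperm_swap
      using IH(2) insert(1,2) assms(3) by simp
    ultimately show ?case by blast
  qed
  moreover have "tensor_id n (transpose x y) = \<tau> UNIV"
    by (rule ext) (simp add: \<tau>_def tensor_id_def)
  ultimately show ?thesis by simp
qed

text \<open>Transpositions generate the permutations of a finite set and \<open>tensor_id\<close> is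
  multiplicative, so the case of a single transposition suffices.\<close>

lemma evenperm_tensor_id:
  fixes \<pi> :: "'a::finite list \<Rightarrow> 'a list"
  assumes even: "even CARD('a)" and "\<pi> permutes words n"
  shows "evenperm (tensor_id n \<pi>)"
  using assms(2) finite_words[of n]
proof (induction rule: permutes_induct)
  case id
  show ?case unfolding tensor_id_id by simp
next
  case (swap x y p)
  have tr: "transpose x y permutes words n"
    using swap by (intro permutes_swap_id)
  have perm: "permutation (tensor_id n \<sigma>)" if "\<sigma> permutes words n" for \<sigma> :: "'a list \<Rightarrow> 'a list"
    using tensor_id_permutes[OF that] finite_words unfolding permutation_permutes by blast
  have "evenperm (tensor_id n (transpose x y))"
    using swap even by (simp add: evenperm_tensor_id_transpose)
  then show ?case
    unfolding tensor_id_comp[OF \<open>p permutes words n\<close>]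
      evenperm_comp[OF perm[OF tr] perm[OF \<open>p permutes words n\<close>]]
    using swap.IH by simp
qed

section \<open>Assembling the two direct limits\<close>

text \<open>Serves both sequences at once: \<open>level i\<close> is the length of the words
  permuted at position \<open>i\<close>, and each connecting map is either a diagonal embedding,
  raising the level by one, or an inclusion, keeping it. The assumption \<open>cofinal\<close>
  supplies surjectivity onto the length-preserving elements.\<close>

lemma lp_thompson_higman_iso_direct_limit:
  fixes G :: "nat \<Rightarrow> ('a::finite list \<Rightarrow> 'a list) monoid" and level :: "nat \<Rightarrow> nat"
  assumes sub: "\<And>i. carrier (G i) \<subseteq> {\<pi>. \<pi> permutes words (level i)}"
    and mult: "\<And>i. mult (G i) = (\<circ>)"
    and mult_closed: "\<And>i \<pi> \<sigma>. \<pi> \<in> carrier (G i) \<Longrightarrow> \<sigma> \<in> carrier (G i) \<Longrightarrow> \<pi> \<circ> \<sigma> \<in> carrier (G i)"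
    and closed: "\<And>i \<pi>. \<pi> \<in> carrier (G i) \<Longrightarrow> f i \<pi> \<in> carrier (G (Suc i))"
    and step: "\<And>i. (f i = tensor_id (level i) \<and> level (Suc i) = Suc (level i)) \<or>
                    (f i = id \<and> level (Suc i) = level i)"
    and cofinal: "\<And>n \<pi>. n \<ge> 1 \<Longrightarrow> \<pi> permutes words n \<Longrightarrow> \<exists>i. level i = n \<and> \<pi> \<in> carrier (G i)"
  shows "(lp_thompson_higman :: ('a list \<rightharpoonup> 'a list) monoid) \<cong> direct_limit G f"
proof -
  define g where "g i \<pi> = max_extension (prefix_map (level i) \<pi>)" for i and \<pi> :: "'a list \<Rightarrow> 'a list"
  have perm: "\<pi> permutes words (level i)" if "\<pi> \<in> carrier (G i)" for i \<pi>
    using sub that by blast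
  show ?thesis
  proof (rule direct_limit_iso[where g = g])
    show "g (Suc i) (f i \<pi>) = g i \<pi>" if "\<pi> \<in> carrier (G i)" for i \<pi>
      using step[of i] max_extension_prefix_map_tensor_id[OF perm[OF that]] by (auto simp: g_def)
    show "g i \<in> hom (G i) lp_thompson_higman" for i
    proof (rule homI)
      fix \<pi> \<sigma> assume \<pi>: "\<pi> \<in> carrier (G i)" and \<sigma>: "\<sigma> \<in> carrier (G i)"
      show "g i \<pi> \<in> carrier lp_thompson_higman"
        using max_extension_in_lp[OF fg_essential_iso_prefix_map length_preserving_prefix_map] perm[OF \<pi>]
        by (simp add: g_def lp_thompson_higman_def)
      show "g i (\<pi> \<otimes>\<^bsub>G i\<^esub> \<sigma>) = g i \<pi> \<otimes>\<^bsub>lp_thompson_higman\<^esub> g i \<sigma>"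
        using max_extension_comp[OF fg_essential_iso_prefix_map[OF perm[OF \<pi>]]
            fg_essential_iso_prefix_map[OF perm[OF \<sigma>]]] prefix_map_comp[OF perm[OF \<sigma>], of \<pi>]
        by (simp add: g_def lp_thompson_higman_def thompson_higman_def mult)
    qed
    show "inj_on (g i) (carrier (G i))" for i
      unfolding g_def by (auto intro!: inj_onI dest: max_extension_prefix_map_inj[OF perm perm])
    show "\<exists>i. \<exists>\<pi>\<in>carrier (G i). g i \<pi> = \<phi>" if "\<phi> \<in> carrier lp_thompson_higman" for \<phi>
    proof -
      from that have "\<phi> \<in> lp_elements" by (simp add: lp_thompson_higman_def)
      then obtain n \<pi> where *: "n \<ge> 1" "\<pi> permutes words n" "max_extension (prefix_map n \<pi>) = \<phi>"
        by (rule lp_elements_prefix_map)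
      from cofinal[OF *(1,2)] *(3) show ?thesis by (auto simp: g_def)
    qed
  qed (use closed mult mult_closed in simp_all)
qed

theorem proposition2p2:
  fixes k :: nat
  assumes "CARD('a::finite) = k" and "k \<ge> 2"
  shows "group (thompson_higman :: ('a list \<rightharpoonup> 'a list) monoid)
    \<and> subgroup lp_elements (thompson_higman :: ('a list \<rightharpoonup> 'a list) monoid)
    \<and> (\<forall>n\<ge>1. tensor_id n \<in> mon (sym_group_on (words n :: 'a list set))
                                (sym_group_on (words (n + 1))))
    \<and> (lp_thompson_higman :: ('a list \<rightharpoonup> 'a list) monoid)
        \<cong> direct_limit (\<lambda>i. sym_group_on (words (i + 1) :: 'a list set)) (\<lambda>i. tensor_id (i + 1))
    \<and> (even k \<longrightarrow>
        (\<forall>n\<ge>1. tensor_id n ` carrier (sym_group_on (words n :: 'a list set))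
                  \<subseteq> carrier (alt_group_on (words (n + 1))))
        \<and> (lp_thompson_higman :: ('a list \<rightharpoonup> 'a list) monoid)
            \<cong> direct_limit (sym_alt_group :: nat \<Rightarrow> ('a list \<Rightarrow> 'a list) monoid) sym_alt_map)"
proof -
  have "(lp_thompson_higman :: ('a list \<rightharpoonup> 'a list) monoid)
        \<cong> direct_limit (\<lambda>i. sym_group_on (words (i + 1) :: 'a list set)) (\<lambda>i. tensor_id (i + 1))"
  proof (rule lp_thompson_higman_iso_direct_limit[where level = Suc])
    show "\<exists>i. Suc i = n \<and> \<pi> \<in> carrier (sym_group_on (words (i + 1)))"
      if "n \<ge> 1" "\<pi> permutes words n" for n and \<pi> :: "'a list \<Rightarrow> 'a list"
      using that by (intro exI[of _ "n - 1"]) (simp add: sym_group_on_def)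
  qed (auto simp: sym_group_on_def permutes_compose tensor_id_permutes)
  moreover have alt: "tensor_id n ` carrier (sym_group_on (words n :: 'a list set))
      \<subseteq> carrier (alt_group_on (words (n + 1)))" if "even k" for n
    using that assms(1)
    by (auto simp: sym_group_on_def alt_group_on_def tensor_id_permutes evenperm_tensor_id)
  moreover have "(lp_thompson_higman :: ('a list \<rightharpoonup> 'a list) monoid)
        \<cong> direct_limit (sym_alt_group :: nat \<Rightarrow> ('a list \<Rightarrow> 'a list) monoid) sym_alt_map"
    if "even k"
  \<comment> \<open>For \<open>n \<ge> 2\<close>, position \<open>2 * (n - 1)\<close> and the odd
    position just before it both have level \<open>n\<close>: the level rises on leaving an even
    position and stays on leaving an odd one.\<close>
  proof (rule lp_thompson_higman_iso_direct_limit
      [where level = "\<lambda>i. if even i then i div 2 + 1 else i div 2 + 2"])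
    fix i and \<pi> \<sigma> :: "'a list \<Rightarrow> 'a list"
    assume \<pi>: "\<pi> \<in> carrier (sym_alt_group i)"
    \<comment> \<open>At even positions \<open>alt\<close> puts the image into the alternating
      group; at odd ones the map is the inclusion and the parity is simply forgotten.\<close>
    show "sym_alt_map i \<pi> \<in> carrier (sym_alt_group (Suc i))"
      using \<pi> alt[OF that, of "i div 2 + 1"]
      by (auto simp: sym_alt_map_def sym_alt_group_def alt_group_on_def sym_group_on_def
          image_subset_iff)
    assume "\<sigma> \<in> carrier (sym_alt_group i)"
    with \<pi> show "\<pi> \<circ> \<sigma> \<in> carrier (sym_alt_group i)"
      by (auto simp: sym_alt_group_def alt_group_on_def sym_group_on_def permutes_compose
          evenperm_comp permutes_imp_permutation[OF finite_words])
  next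
    show "\<exists>i. (if even i then i div 2 + 1 else i div 2 + 2) = n \<and> \<pi> \<in> carrier (sym_alt_group i)"
      if "n \<ge> 1" "\<pi> permutes words n" for n and \<pi> :: "'a list \<Rightarrow> 'a list"
      \<comment> \<open>The symmetric groups at even positions already contain every permutation of
        \<open>words n\<close> with \<open>n \<ge> 1\<close>.\<close>
      using that by (intro exI[of _ "2 * (n - 1)"]) (simp add: sym_alt_group_def sym_group_on_def)
  qed (auto simp: sym_alt_group_def alt_group_on_def sym_group_on_def sym_alt_map_def)
  ultimately show ?thesis
    using group_thompson_higman subgroup_lp_elements tensor_id_mon by blast
qed

end
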